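(* Let $\mu\in\mathbb{R}$, $\sigma>0$, $\delta=\mu/\sigma$, and let $1\le r<s<t\le n$. Let $X_{1:n}<\dots<X_{n:n}$ be the order statistics of a sample of size $n$ from the density $\frac1\sigma f\left(\frac{x-\mu}{\sigma}\right)$, and let $\boldsymbol X=(X_{1:n},\dots,X_{r:n})^\top$. Then the joint best linear invariant predictors $(\hat X_{s:n},\hat X_{t:n})$ of $(X_{s:n},X_{t:n})$, i.e. the pair of the form $(\boldsymbol a^\top\boldsymbol X,\boldsymbol b^\top\boldsymbol X)$, $\boldsymbol a,\boldsymbol b\in\mathbb{R}^r$, that minimizes the determinant of the mean squared predictive error matrix $E[\boldsymbol e\boldsymbol e^\top]$, $\boldsymbol e=(\boldsymbol a^\top\boldsymbol X-X_{s:n},\ \boldsymbol b^\top\boldsymbol X-X_{t:n})^\top$, over $\boldsymbol a,\boldsymbol b\in\mathbb{R}^r$, are $\hat X_{s:n}=\boldsymbol a^\top\boldsymbol X$ and $\hat X_{t:n}=\boldsymbol b^\top\boldsymbol X$ with $$\boldsymbol a=\boldsymbol\Gamma^{-1}\boldsymbol\Delta_s,\qquad \boldsymbol b=\boldsymbol\Gamma^{-1}\boldsymbol\Delta_t,$$ where $\boldsymbol\Gamma=\boldsymbol\Sigma+(\boldsymbol\alpha+\delta\boldsymbol 1)(\boldsymbol\alpha+\delta\boldsymbol 1)^\top$, $\boldsymbol\Delta_s=\boldsymbol\omega_s+(\alpha_s+\delta)(\boldsymbol\alpha+\delta\boldsymbol 1)$ and $\boldsymbol\Delta_t=\boldsymbol\omega_t+(\alpha_t+\delta)(\boldsymbol\alpha+\delta\boldsymbol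 1)$.
   Context: $f$ is a probability density on $\mathbb{R}$, and the sample consists of $n$ i.i.d. random variables with density $\frac1\sigma f\left(\frac{x-\mu}{\sigma}\right)$ (location-scale family). The standardized order statistics are $Z_{i:n}=(X_{i:n}-\mu)/\sigma$, $1\le i\le n$, assumed to have finite second moments. Notation: $\alpha_i=E[Z_{i:n}]$ for $1\le i\le n$; $\boldsymbol\alpha=(\alpha_1,\dots,\alpha_r)^\top$; $\boldsymbol 1=(1,\dots,1)^\top\in\mathbb{R}^r$; $\boldsymbol\Sigma$ is the $r\times r$ covariance matrix of $(Z_{1:n},\dots,Z_{r:n})^\top$, assumed positive definite; $\boldsymbol\omega_q=(\mathrm{Cov}(Z_{1:n},Z_{q:n}),\dots,\mathrm{Cov}(Z_{r:n},Z_{q:n}))^\top\in\mathbb{R}^r$ for $q\in\{s,t\}$. The minimization is for fixed $\mu,\sigma$, over all coefficient vectors in $\mathbb{R}^r$, with no unbiasedness constraint. *)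

theory Defs
  imports
    "HOL-Probability.Probability"
    "Jordan_Normal_Form.Determinant"
    "Jordan_Normal_Form.Gauss_Jordan_Elimination"
begin

no_notation Finite_Cartesian_Product.vec_nth (infixl "$" 90)
no_notation Inner_Product.real_inner_class.inner (infix "\<bullet>" 70)
hide_const (open) Finite_Cartesian_Product.vec Determinants.det

definition probability_density :: "(real \<Rightarrow> real) \<Rightarrow> bool" where
  "probability_density f \<longleftrightarrow>
     f \<in> borel_measurable borel \<and> (\<forall>x. 0 \<le> f x) \<and> (\<integral>\<^sup>+x. ennreal (f x) \<partial>lborel) = 1"

definition order_stat :: "nat \<Rightarrow> (nat \<Rightarrow> 'a \<Rightarrow> real) \<Rightarrow> nat \<Rightarrow> 'a \<Rightarrow> real" where
  "order_stat n Y i \<omega> = sort (map (\<lambda>j. Y j \<omega>) [1..<n+1]) ! (i - 1)"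

definition covariance :: "'a measure \<Rightarrow> ('a \<Rightarrow> real) \<Rightarrow> ('a \<Rightarrow> real) \<Rightarrow> real" where
  "covariance M U V =
     (\<integral>\<omega>. (U \<omega> - (\<integral>\<eta>. U \<eta> \<partial>M)) * (V \<omega> - (\<integral>\<eta>. V \<eta> \<partial>M)) \<partial>M)"

text \<open>Vectors and matrices are indexed from 0, the random variables from 1.\<close>

definition rv_vec :: "nat \<Rightarrow> (nat \<Rightarrow> 'a \<Rightarrow> real) \<Rightarrow> 'a \<Rightarrow> real vec" where
  "rv_vec r X \<omega> = vec r (\<lambda>i. X (i + 1) \<omega>)"

definition cov_mat :: "'a measure \<Rightarrow> nat \<Rightarrow> (nat \<Rightarrow> 'a \<Rightarrow> real) \<Rightarrow> real mat" where
  "cov_mat M r Z = mat r r (\<lambda>(i, j). covariance M (Z (i + 1)) (Z (j + 1)))"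

definition cov_vec :: "'a measure \<Rightarrow> nat \<Rightarrow> (nat \<Rightarrow> 'a \<Rightarrow> real) \<Rightarrow> nat \<Rightarrow> real vec" where
  "cov_vec M r Z q = vec r (\<lambda>i. covariance M (Z (i + 1)) (Z q))"

definition outer_prod :: "real vec \<Rightarrow> real vec \<Rightarrow> real mat" where
  "outer_prod u v = mat (dim_vec u) (dim_vec v) (\<lambda>(i, j). u $ i * v $ j)"

definition positive_definite :: "real mat \<Rightarrow> bool" where
  "positive_definite A \<longleftrightarrow>
     square_mat A \<and> A\<^sup>T = A \<and>
     (\<forall>v \<in> carrier_vec (dim_row A). v \<noteq> 0\<^sub>v (dim_row A) \<longrightarrow> 0 < v \<bullet> (A *\<^sub>v v))"

text \<open>\<^const>\<open>mat_inverse\<close> is \<^const>\<open>None\<close> on a singular matrix, on which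
  the following is unspecified.\<close>

definition inv_mat :: "real mat \<Rightarrow> real mat" where
  "inv_mat A = the (mat_inverse A)"

definition pred_error ::
  "nat \<Rightarrow> (nat \<Rightarrow> 'a \<Rightarrow> real) \<Rightarrow> nat \<Rightarrow> nat \<Rightarrow> real vec \<Rightarrow> real vec \<Rightarrow> 'a \<Rightarrow> real vec" where
  "pred_error r X s t a b \<omega> =
     vec_of_list [a \<bullet> rv_vec r X \<omega> - X s \<omega>, b \<bullet> rv_vec r X \<omega> - X t \<omega>]"

definition mspe_mat ::
  "'a measure \<Rightarrow> nat \<Rightarrow> (nat \<Rightarrow> 'a \<Rightarrow> real) \<Rightarrow> nat \<Rightarrow> nat \<Rightarrow> real vec \<Rightarrow> real vec \<Rightarrow> real mat" where
  "mspe_mat M r X s t a b =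
     mat 2 2 (\<lambda>(i, j). \<integral>\<omega>. outer_prod (pred_error r X s t a b \<omega>) (pred_error r X s t a b \<omega>) $$ (i, j) \<partial>M)"

definition joint_BLIP ::
  "'a measure \<Rightarrow> nat \<Rightarrow> (nat \<Rightarrow> 'a \<Rightarrow> real) \<Rightarrow> nat \<Rightarrow> nat \<Rightarrow> real vec \<Rightarrow> real vec \<Rightarrow> bool" where
  "joint_BLIP M r X s t a b \<longleftrightarrow>
     is_arg_min (\<lambda>(a, b). det (mspe_mat M r X s t a b))
       (\<lambda>(a, b). a \<in> carrier_vec r \<and> b \<in> carrier_vec r) (a, b)"

end

theory Submission
  imports Defs
begin

text \<open>The normal equations make the residuals \<open>e\<^sub>0\<close> of the claimed predictors orthogonal to every
  linear combination of the observations. Hence the error matrix of an arbitrary pair is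
  \<open>D + G\<close>, where \<open>D\<close> is the Gram matrix of \<open>e\<^sub>0\<close> and \<open>G\<close> the Gram matrix of the
  deviation. Minimality of \<open>det D\<close> only needs \<open>D\<close> positive semidefinite, but uniqueness fails if
  \<open>D\<close> is singular. It is regular because the joint law of the sample has a density, so that
  almost surely no nontrivial linear relation holds between the order statistics.\<close>

section \<open>Determinants of sums of Gram matrices\<close>

text \<open>Evaluating the form at \<open>(-K, G)\<close> gives \<open>G\<close> times its
  determinant, which settles the sign unless \<open>G\<close> vanishes; the degenerate case needs
  another test vector.\<close>

lemma psd2_imp_det_nonneg:
  fixes G H K :: real
  assumes "\<And>x y. 0 \<le> x\<^sup>2 * G + 2 * (x * y) * K + y\<^sup>2 * H"
  shows "0 \<le> G" "0 \<le> H" "K\<^sup>2 \<le> G * H"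
proof -
  show G: "0 \<le> G" and H: "0 \<le> H"
    using assms[of 1 0] assms[of 0 1] by simp_all
  show "K\<^sup>2 \<le> G * H"
  proof (cases "G = 0")
    case True
    \<comment> \<open>With \<open>G = 0\<close> the form at \<open>(-(H + 1), K)\<close> equals
      \<open>-(H + 2) * K\<^sup>2\<close>; since \<open>H + 2\<close> is positive, \<open>K\<close>
      must vanish.\<close>
    have "0 \<le> - 2 * (H + 1) * K\<^sup>2 + K\<^sup>2 * H"
      using assms[of "- (H + 1)" K] True by (simp add: power2_eq_square algebra_simps)
    then have "K\<^sup>2 * (H + 2) \<le> 0" by (simp add: algebra_simps)
    then show ?thesis using True H by (simp add: mult_le_0_iff)
  next
    case False
    have "0 \<le> G * (G * H - K\<^sup>2)"
      using assms[of "- K" G] by (simp add: power2_eq_square algebra_simps)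
    then show ?thesis using False G by (simp add: zero_le_mult_iff)
  qed
qed

lemma pd2_imp_det_pos:
  fixes A B C :: real
  assumes "\<And>x y. x \<noteq> 0 \<or> y \<noteq> 0 \<Longrightarrow> 0 < x\<^sup>2 * A + 2 * (x * y) * C + y\<^sup>2 * B"
  shows "0 < A" "0 < B" "C\<^sup>2 < A * B"
proof -
  show A: "0 < A" and "0 < B"
    using assms[of 1 0] assms[of 0 1] by simp_all
  have "0 < A * (A * B - C\<^sup>2)"
    using assms[of "- C" A] A by (simp add: power2_eq_square algebra_simps)
  then show "C\<^sup>2 < A * B" using A by (simp add: zero_less_mult_iff)
qed

text \<open>Adding the matrix with diagonal \<open>G\<close>, \<open>H\<close> and off-diagonal
  entry \<open>K\<close> raises the determinant by \<open>G * H - K\<^sup>2\<close> plus a mixed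
  term \<open>T\<close>, the trace of the adjugate of the first matrix times the second. Both
  increments are nonnegative, and positive definiteness of the first matrix makes
  \<open>T = 0\<close> force the second to vanish.\<close>

lemma det2_add_psd:
  fixes A B C G H K :: real
  assumes A: "0 < A" and B: "0 < B" and C: "C\<^sup>2 < A * B"
    and G: "0 \<le> G" and H: "0 \<le> H" and K: "K\<^sup>2 \<le> G * H"
  shows "A * B - C\<^sup>2 \<le> (A + G) * (B + H) - (C + K)\<^sup>2"
    and "(A + G) * (B + H) - (C + K)\<^sup>2 \<le> A * B - C\<^sup>2 \<Longrightarrow> G = 0 \<and> H = 0"
proof -
  define T where "T = A * H + B * G - 2 * C * K"
  \<comment> \<open>This is the semidefinite form with coefficients \<open>G\<close>,
    \<open>K\<close>, \<open>H\<close> evaluated at \<open>(-C, A)\<close>. Multiplied by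
    \<open>G\<close> it dominates a complete square.\<close>
  have Q: "0 \<le> A\<^sup>2 * H - 2 * (A * C * K) + C\<^sup>2 * G"
  proof (cases "G = 0")
    case True
    then show ?thesis using K H by simp
  next
    case False
    have "0 \<le> (A * K - C * G)\<^sup>2" by simp
    also have "\<dots> = A\<^sup>2 * K\<^sup>2 - 2 * (A * C * K * G) + C\<^sup>2 * G\<^sup>2"
      by (simp add: power2_eq_square algebra_simps)
    also have "\<dots> \<le> A\<^sup>2 * (G * H) - 2 * (A * C * K * G) + C\<^sup>2 * G\<^sup>2"
      using mult_left_mono[OF K, of "A\<^sup>2"] by simp
    also have "\<dots> = G * (A\<^sup>2 * H - 2 * (A * C * K) + C\<^sup>2 * G)"
      by (simp add: power2_eq_square algebra_simps)
    finally show ?thesis using False G by (simp add: zero_le_mult_iff)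
  qed
  have AT: "A * T = (A\<^sup>2 * H - 2 * (A * C * K) + C\<^sup>2 * G) + (A * B - C\<^sup>2) * G"
    by (simp add: T_def power2_eq_square algebra_simps)
  have "0 \<le> A * T" unfolding AT using Q C G by simp
  then have T: "0 \<le> T" using A by (simp add: zero_le_mult_iff)
  have eq: "(A + G) * (B + H) - (C + K)\<^sup>2 = (A * B - C\<^sup>2) + T + (G * H - K\<^sup>2)"
    by (simp add: T_def power2_eq_square algebra_simps)
  show "A * B - C\<^sup>2 \<le> (A + G) * (B + H) - (C + K)\<^sup>2"
    unfolding eq using T K by simp
  assume "(A + G) * (B + H) - (C + K)\<^sup>2 \<le> A * B - C\<^sup>2"
  then have T0: "T = 0" unfolding eq using T K by linarith
  \<comment> \<open>\<open>A * T = 0\<close> is a sum of two nonnegative terms, so each of them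
    vanishes; then \<open>G\<close>, \<open>K\<close> and \<open>H\<close> fall one after the
    other.\<close>
  have "(A * B - C\<^sup>2) * G \<le> 0" using AT T0 Q by simp
  then have G0: "G = 0" using C G by (simp add: mult_le_0_iff)
  moreover have "K = 0" using K G0 by simp
  ultimately show "G = 0 \<and> H = 0" using T0 A by (simp add: T_def)
qed

section \<open>Square-integrable random variables\<close>

text \<open>Measurability of \<open>U\<close> is demanded separately because integrability of the
  square does not control the sign of \<open>U\<close>.\<close>

definition square_integrable :: "'a measure \<Rightarrow> ('a \<Rightarrow> real) \<Rightarrow> bool" where
  "square_integrable M U \<longleftrightarrow> U \<in> borel_measurable M \<and> integrable M (\<lambda>x. (U x)\<^sup>2)"

lemma square_integrable_mult:
  assumes "square_integrable M U" "square_integrable M V"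
  shows "integrable M (\<lambda>x. U x * V x)"
proof (rule Bochner_Integration.integrable_bound)
  show "integrable M (\<lambda>x. (U x)\<^sup>2 + (V x)\<^sup>2)"
    using assms by (simp add: square_integrable_def)
  show "(\<lambda>x. U x * V x) \<in> borel_measurable M"
    using assms by (auto simp: square_integrable_def)
  have "\<bar>u * v\<bar> \<le> u\<^sup>2 + v\<^sup>2" for u v :: real
    using sum_squares_bound[of "\<bar>u\<bar>" "\<bar>v\<bar>"] mult_nonneg_nonneg[of "\<bar>u\<bar>" "\<bar>v\<bar>"]
    unfolding abs_mult power2_abs by linarith
  then show "AE x in M. norm (U x * V x) \<le> norm ((U x)\<^sup>2 + (V x)\<^sup>2)"
    by simp
qed

lemma square_integrable_cmult:
  "square_integrable M U \<Longrightarrow> square_integrable M (\<lambda>x. c * U x)"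
  by (auto simp: square_integrable_def power_mult_distrib)

lemma square_integrable_add:
  assumes "square_integrable M U" "square_integrable M V"
  shows "square_integrable M (\<lambda>x. U x + V x)"
  using assms square_integrable_mult[OF assms]
  by (auto simp: square_integrable_def power2_sum mult.assoc)

lemma square_integrable_diff:
  assumes "square_integrable M U" "square_integrable M V"
  shows "square_integrable M (\<lambda>x. U x - V x)"
  using square_integrable_add[OF assms(1) square_integrable_cmult[OF assms(2), of "-1"]] by simp

lemma square_integrable_sum:
  "(\<And>i. i \<in> I \<Longrightarrow> square_integrable M (U i)) \<Longrightarrow> square_integrable M (\<lambda>x. \<Sum>i\<in>I. U i x)"
proof (induction I rule: infinite_finite_induct)
  case (insert i I)
  then show ?case by (simp add: square_integrable_add)
\<comment> \<open>The remaining cases are the empty and the infinite index set; in both the sum is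
  0.\<close>
qed (simp_all add: square_integrable_def)

lemma (in finite_measure) square_integrable_const: "square_integrable M (\<lambda>x. c)"
  by (simp add: square_integrable_def)

lemma (in finite_measure) square_integrable_imp_integrable':
  "square_integrable M U \<Longrightarrow> integrable M U"
  by (auto simp: square_integrable_def intro: square_integrable_imp_integrable)

text \<open>Identifies the quadratic form of the Gram matrix of \<open>U\<close> and
  \<open>V\<close> with a second moment, so that its sign can be read off pointwise.\<close>

lemma integral_square_lincomb:
  assumes U: "square_integrable M U" and V: "square_integrable M V"
  shows "(\<integral>\<omega>. (x * U \<omega> + y * V \<omega>)\<^sup>2 \<partial>M) =
    x\<^sup>2 * (\<integral>\<omega>. (U \<omega>)\<^sup>2 \<partial>M) + 2 * (x * y) * (\<integral>\<omega>. U \<omega> * V \<omega> \<partial>M) + y\<^sup>2 * (\<integral>\<omega>. (V \<omega>)\<^sup>2 \<partial>M)"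
proof -
  have "(\<integral>\<omega>. (x * U \<omega> + y * V \<omega>)\<^sup>2 \<partial>M) =
      (\<integral>\<omega>. x\<^sup>2 * (U \<omega>)\<^sup>2 + 2 * (x * y) * (U \<omega> * V \<omega>) + y\<^sup>2 * (V \<omega>)\<^sup>2 \<partial>M)"
    by (simp add: power2_eq_square algebra_simps)
  then show ?thesis
    using U V square_integrable_mult[OF U V] by (simp add: square_integrable_def)
qed

text \<open>A vanishing integral would make \<open>U\<close> zero almost everywhere, so that a
  contradictory event would have probability one.\<close>

lemma (in prob_space) integral_square_pos:
  assumes "square_integrable M U" "AE \<omega> in M. U \<omega> \<noteq> 0"
  shows "0 < (\<integral>\<omega>. (U \<omega>)\<^sup>2 \<partial>M)"
proof -
  have "(\<integral>\<omega>. (U \<omega>)\<^sup>2 \<partial>M) \<noteq> 0"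
  proof
    assume "(\<integral>\<omega>. (U \<omega>)\<^sup>2 \<partial>M) = 0"
    then have "AE \<omega> in M. (U \<omega>)\<^sup>2 = 0"
      using assms(1) by (subst (asm) integral_nonneg_eq_0_iff_AE) (auto simp: square_integrable_def)
    with assms(2) have "AE \<omega> in M. False" by eventually_elim simp
    then show False by simp
  qed
  then show ?thesis by (simp add: less_le)
qed

text \<open>Orthogonality removes every mixed moment, so the Gram matrix of the perturbed pair is
  the sum of the Gram matrices of \<open>(U, V)\<close> and \<open>(g, h)\<close>. \<open>D\<close>
  is the Gram determinant, to which \<open>det2_add_psd\<close> applies.\<close>

lemma gram_det_perturb:
  fixes U V g h :: "'a \<Rightarrow> real"
  assumes sq: "square_integrable M U" "square_integrable M V"
      "square_integrable M g" "square_integrable M h"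
    and orth: "(\<integral>\<omega>. U \<omega> * g \<omega> \<partial>M) = 0" "(\<integral>\<omega>. U \<omega> * h \<omega> \<partial>M) = 0"
      "(\<integral>\<omega>. V \<omega> * g \<omega> \<partial>M) = 0" "(\<integral>\<omega>. V \<omega> * h \<omega> \<partial>M) = 0"
    and indep: "\<And>x y. x \<noteq> 0 \<or> y \<noteq> 0 \<Longrightarrow> 0 < (\<integral>\<omega>. (x * U \<omega> + y * V \<omega>)\<^sup>2 \<partial>M)"
  defines "D \<equiv> \<lambda>P Q. (\<integral>\<omega>. (P \<omega>)\<^sup>2 \<partial>M) * (\<integral>\<omega>. (Q \<omega>)\<^sup>2 \<partial>M) - (\<integral>\<omega>. P \<omega> * Q \<omega> \<partial>M)\<^sup>2"
  shows "D U V \<le> D (\<lambda>\<omega>. U \<omega> + g \<omega>) (\<lambda>\<omega>. V \<omega> + h \<omega>)"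
    and "D (\<lambda>\<omega>. U \<omega> + g \<omega>) (\<lambda>\<omega>. V \<omega> + h \<omega>) \<le> D U V \<Longrightarrow>
      (\<integral>\<omega>. (g \<omega>)\<^sup>2 \<partial>M) = 0 \<and> (\<integral>\<omega>. (h \<omega>)\<^sup>2 \<partial>M) = 0"
proof -
  note int = square_integrable_mult[OF sq(1) sq(2)] square_integrable_mult[OF sq(1) sq(4)]
    square_integrable_mult[OF sq(2) sq(3)] square_integrable_mult[OF sq(3) sq(4)]
  have UG: "(\<integral>\<omega>. (U \<omega> + g \<omega>)\<^sup>2 \<partial>M) = (\<integral>\<omega>. (U \<omega>)\<^sup>2 \<partial>M) + (\<integral>\<omega>. (g \<omega>)\<^sup>2 \<partial>M)"
    using integral_square_lincomb[OF sq(1) sq(3), of 1 1] orth by simp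
  have VH: "(\<integral>\<omega>. (V \<omega> + h \<omega>)\<^sup>2 \<partial>M) = (\<integral>\<omega>. (V \<omega>)\<^sup>2 \<partial>M) + (\<integral>\<omega>. (h \<omega>)\<^sup>2 \<partial>M)"
    using integral_square_lincomb[OF sq(2) sq(4), of 1 1] orth by simp
  have "(\<integral>\<omega>. (U \<omega> + g \<omega>) * (V \<omega> + h \<omega>) \<partial>M) =
      (\<integral>\<omega>. U \<omega> * V \<omega> + U \<omega> * h \<omega> + (V \<omega> * g \<omega> + g \<omega> * h \<omega>) \<partial>M)"
    by (simp add: algebra_simps)
  then have UV: "(\<integral>\<omega>. (U \<omega> + g \<omega>) * (V \<omega> + h \<omega>) \<partial>M) =
      (\<integral>\<omega>. U \<omega> * V \<omega> \<partial>M) + (\<integral>\<omega>. g \<omega> * h \<omega> \<partial>M)"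
    using int orth by simp
  note pd = pd2_imp_det_pos[OF indep[unfolded integral_square_lincomb[OF sq(1,2)]]]
  have "0 \<le> x\<^sup>2 * (\<integral>\<omega>. (g \<omega>)\<^sup>2 \<partial>M) + 2 * (x * y) * (\<integral>\<omega>. g \<omega> * h \<omega> \<partial>M) + y\<^sup>2 * (\<integral>\<omega>. (h \<omega>)\<^sup>2 \<partial>M)"
    for x y
    unfolding integral_square_lincomb[OF sq(3,4), symmetric] by simp
  note psd = psd2_imp_det_nonneg[OF this]
  show "D U V \<le> D (\<lambda>\<omega>. U \<omega> + g \<omega>) (\<lambda>\<omega>. V \<omega> + h \<omega>)"
    unfolding D_def UG VH UV by (rule det2_add_psd(1)[OF pd psd])
  show "(\<integral>\<omega>. (g \<omega>)\<^sup>2 \<partial>M) = 0 \<and> (\<integral>\<omega>. (h \<omega>)\<^sup>2 \<partial>M) = 0"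
    if "D (\<lambda>\<omega>. U \<omega> + g \<omega>) (\<lambda>\<omega>. V \<omega> + h \<omega>) \<le> D U V"
    by (rule det2_add_psd(2)[OF pd psd that[unfolded D_def UG VH UV]])
qed

section \<open>Order statistics\<close>

text \<open>In a sorted list the entries up to \<open>x\<close> form a prefix, and their number is
  unchanged by sorting. This replaces sorting by counting, which is easily seen to be
  measurable.\<close>

lemma sort_nth_le_iff:
  fixes xs :: "'b::linorder list"
  assumes "k < length xs"
  shows "sort xs ! k \<le> x \<longleftrightarrow> k < length (filter (\<lambda>y. y \<le> x) xs)"
proof -
  define ys where "ys = sort xs"
  have "length (filter (\<lambda>y. y \<le> x) xs) = length (filter (\<lambda>y. y \<le> x) ys)"
    by (simp add: ys_def filter_sort)
  moreover have "filter (\<lambda>y. y \<le> x) ys = takeWhile (\<lambda>y. y \<le> x) ys"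
  proof (rule takeWhile_eq_filter[symmetric])
    fix y assume y: "y \<in> set (dropWhile (\<lambda>y. y \<le> x) ys)"
    then have ne: "dropWhile (\<lambda>y. y \<le> x) ys \<noteq> []" by (metis emptyE set_empty)
    have "sorted (dropWhile (\<lambda>y. y \<le> x) ys)"
      by (simp add: ys_def sorted_dropWhile)
    with y ne have "hd (dropWhile (\<lambda>y. y \<le> x) ys) \<le> y"
      by (cases "dropWhile (\<lambda>y. y \<le> x) ys") auto
    with hd_dropWhile[OF ne] show "\<not> y \<le> x" by (meson order_trans)
  qed
  moreover have "ys ! k \<le> x \<longleftrightarrow> k < length (takeWhile (\<lambda>y. y \<le> x) ys)"
  proof
    assume k: "k < length (takeWhile (\<lambda>y. y \<le> x) ys)"
    then have "takeWhile (\<lambda>y. y \<le> x) ys ! k \<le> x"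
      by (meson nth_mem set_takeWhileD)
    with k show "ys ! k \<le> x" by (simp add: takeWhile_nth)
  next
    assume k: "ys ! k \<le> x"
    show "k < length (takeWhile (\<lambda>y. y \<le> x) ys)"
    proof (rule ccontr)
      assume "\<not> ?thesis"
      then have l: "length (takeWhile (\<lambda>y. y \<le> x) ys) \<le> k" by simp
      moreover have "k < length ys" using assms by (simp add: ys_def)
      \<comment> \<open>The first entry after the prefix exceeds \<open>x\<close>, yet by sortedness
        it is at most \<open>ys ! k\<close>, hence at most \<open>x\<close>.\<close>
      ultimately have "ys ! length (takeWhile (\<lambda>y. y \<le> x) ys) \<le> ys ! k"
        by (intro sorted_nth_mono) (simp_all add: ys_def)
      then show False
        using nth_length_takeWhile[of "\<lambda>y. y \<le> x" ys] k l \<open>k < length ys\<close> by auto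
    qed
  qed
  ultimately show ?thesis by (simp add: ys_def)
qed

lemma borel_measurable_order_stat:
  assumes Y: "\<And>j. j \<in> {1..n} \<Longrightarrow> Y j \<in> borel_measurable M" and i: "i \<in> {1..n}"
  shows "order_stat n Y i \<in> borel_measurable M"
proof (rule borel_measurable_iff_le[THEN iffD2], rule allI)
  fix x
  have i': "i - 1 < n" using i by auto
  \<comment> \<open>The sublevel event says that at least \<open>i\<close> sample values are at most
    \<open>x\<close>; it is written with a sum of indicators because such a sum is
    measurable.\<close>
  have "order_stat n Y i \<omega> \<le> x \<longleftrightarrow> i - 1 < (\<Sum>j\<in>{1..n}. if Y j \<omega> \<le> x then 1 else 0)" for \<omega>
  proof -
    have "length (filter (\<lambda>y. y \<le> x) (map (\<lambda>j. Y j \<omega>) [1..<n+1])) =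
        length (filter (\<lambda>j. Y j \<omega> \<le> x) [1..<n+1])"
      by (simp only: filter_map comp_def length_map)
    also have "\<dots> = card ({j. Y j \<omega> \<le> x} \<inter> set [1..<n+1])"
      by (rule distinct_length_filter) (rule distinct_upt)
    also have "{j. Y j \<omega> \<le> x} \<inter> set [1..<n+1] = {j \<in> {1..n}. Y j \<omega> \<le> x}"
      by auto
    finally have "order_stat n Y i \<omega> \<le> x \<longleftrightarrow> i - 1 < card {j \<in> {1..n}. Y j \<omega> \<le> x}"
      unfolding order_stat_def using i' by (subst sort_nth_le_iff) (simp_all del: upt_Suc)
    then show ?thesis by (simp only: card_eq_sum sum.inter_filter[OF finite_atLeastAtMost])
  qed
  moreover have "{\<omega> \<in> space M. i - 1 < (\<Sum>j\<in>{1..n}. if Y j \<omega> \<le> x then 1 else 0 :: nat)} \<in> sets M"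
  proof -
    have "Measurable.pred M (\<lambda>\<omega>. Y j \<omega> \<le> x)" if "j \<in> {1..n}" for j
      using Y[OF that] by measurable
    then have "(\<lambda>\<omega>. \<Sum>j\<in>{1..n}. if Y j \<omega> \<le> x then 1 else 0 :: nat) \<in> measurable M (count_space UNIV)"
      by (intro measurable_sum_nat measurable_If) auto
    then show ?thesis by measurable
  qed
  ultimately show "{\<omega> \<in> space M. order_stat n Y i \<omega> \<le> x} \<in> sets M" by simp
qed

text \<open>The permutation depends on the sample point \<open>\<omega>\<close>; only the finiteness
  of the set of candidates is exploited later.\<close>

lemma order_stat_permutation:
  obtains p where "p permutes {1..n}" "\<And>i. i \<in> {1..n} \<Longrightarrow> order_stat n Y i \<omega> = Y (p i) \<omega>"
proof -
  let ?ys = "map (\<lambda>j. Y j \<omega>) [1..<n+1]"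
  obtain q where q: "q permutes {..<length ?ys}" "permute_list q ?ys = sort ?ys"
    using mset_eq_permutation[of "sort ?ys" ?ys] by auto
  then have q': "q permutes {..<n}" by (simp del: upt_Suc)
  \<comment> \<open>Shifts the permutation \<open>q\<close> of list positions, counted from 0, to
    sample indices, counted from 1; outside the index range it is the identity, as
    \<open>permutes\<close> requires.\<close>
  define p where "p = (\<lambda>i. if i \<in> {1..n} then Suc (q (i - 1)) else i)"
  have "bij_betw (\<lambda>i. Suc (q (i - 1))) {1..n} {1..n}"
  proof -
    have pre: "bij_betw (\<lambda>i. i - 1) {1..n} {..<n}"
      by (rule bij_betwI[where g = Suc]) auto
    have post: "bij_betw Suc {..<n} {1..n}"
      by (rule bij_betwI[where g = "\<lambda>i. i - 1"]) auto
    show ?thesis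
      using bij_betw_trans[OF bij_betw_trans[OF pre permutes_imp_bij[OF q']] post]
      by (simp add: comp_def)
  qed
  then have "bij_betw p {1..n} {1..n}"
    by (subst bij_betw_cong[of _ _ "\<lambda>i. Suc (q (i - 1))"]) (auto simp: p_def)
  then have "p permutes {1..n}"
    by (rule bij_imp_permutes) (auto simp: p_def)
  moreover have "order_stat n Y i \<omega> = Y (p i) \<omega>" if "i \<in> {1..n}" for i
  proof -
    have k: "i - 1 < n" using that by auto
    then have "q (i - 1) < n" using permutes_in_image[OF q', of "i - 1"] by simp
    then show ?thesis
      unfolding order_stat_def q(2)[symmetric]
      using k that q(1) by (simp add: permute_list_nth p_def del: upt_Suc)
  qed
  ultimately show ?thesis by (rule that)
qed

section \<open>Absence of linear relations\<close>

text \<open>By independence the joint law is a product, and by Fubini it suffices that for each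
  fixed value \<open>v\<close> the atomless variable \<open>U\<close> avoids \<open>-v\<close>
  almost surely.\<close>

lemma (in prob_space) indep_var_AE_add_neq_0:
  fixes U V :: "'a \<Rightarrow> real"
  assumes indep: "indep_var borel U borel V"
    and cont: "\<And>x. AE \<omega> in M. U \<omega> \<noteq> x"
  shows "AE \<omega> in M. U \<omega> + V \<omega> \<noteq> 0"
proof -
  have [measurable]: "U \<in> borel_measurable M" "V \<in> borel_measurable M"
    and eq: "distr M borel U \<Otimes>\<^sub>M distr M borel V = distr M (borel \<Otimes>\<^sub>M borel) (\<lambda>x. (U x, V x))"
    using indep by (auto simp: indep_var_distribution_eq)
  interpret U: prob_space "distr M borel U" by (rule prob_space_distr) simp
  interpret V: prob_space "distr M borel V" by (rule prob_space_distr) simp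
  interpret UV: pair_sigma_finite "distr M borel U" "distr M borel V" ..
  have "AE v in distr M borel V. AE u in distr M borel U. u + v \<noteq> 0"
  proof (rule AE_I2)
    fix v
    show "AE u in distr M borel U. u + v \<noteq> 0"
      using cont[of "- v"] by (simp add: AE_distr_iff eq_neg_iff_add_eq_0)
  qed
  moreover have meas: "{x \<in> space (distr M borel U \<Otimes>\<^sub>M distr M borel V). fst x + snd x \<noteq> 0}
      \<in> sets (distr M borel U \<Otimes>\<^sub>M distr M borel V)"
    by measurable
  \<comment> \<open>The quantifiers are exchanged because the product-measure criterion takes the
    first coordinate outermost, whereas the atomless variable had to be innermost.\<close>
  ultimately have "AE u in distr M borel U. AE v in distr M borel V. u + v \<noteq> 0"
    using UV.AE_commute[OF meas] by simp
  then have "AE x in distr M borel U \<Otimes>\<^sub>M distr M borel V. fst x + snd x \<noteq> 0"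
    using UV.AE_pair_iff[OF meas] by simp
  then show ?thesis
    unfolding eq by (subst (asm) AE_distr_iff) auto
qed

lemma (in prob_space) distributed_lborel_AE_neq:
  fixes U :: "'a \<Rightarrow> real"
  assumes "distributed M lborel U f"
  shows "AE \<omega> in M. U \<omega> \<noteq> x"
proof -
  have "AE u in density lborel f. u \<noteq> x"
    using AE_lborel_singleton[of x] distributed_borel_measurable[OF assms]
    by (subst AE_density) auto
  then have "AE u in distr M lborel U. u \<noteq> x"
    by (subst distributed_distr_eq_density[OF assms])
  then show ?thesis
    using distributed_measurable[OF assms] by (subst (asm) AE_distr_iff) auto
qed

text \<open>The term with index \<open>j\<close> is still atomless after scaling by a nonzero
  coefficient, and it is independent of the sum of the others.\<close>

lemma (in prob_space) indep_vars_AE_lincomb_neq_0: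
  fixes Y :: "'i \<Rightarrow> 'a \<Rightarrow> real"
  assumes I: "finite I" and indep: "indep_vars (\<lambda>_. borel) Y I"
    and cont: "\<And>i x. i \<in> I \<Longrightarrow> AE \<omega> in M. Y i \<omega> \<noteq> x"
    and j: "j \<in> I" "c j \<noteq> 0"
  shows "AE \<omega> in M. (\<Sum>i\<in>I. c i * Y i \<omega>) \<noteq> 0"
proof -
  have "indep_vars (\<lambda>_. borel) (\<lambda>i \<omega>. c i * Y i \<omega>) (insert j (I - {j}))"
    using indep_vars_compose2[OF indep, of "\<lambda>i. (*) (c i)" "\<lambda>_. borel"] j
    by (simp add: insert_absorb)
  then have "indep_var borel (\<lambda>\<omega>. c j * Y j \<omega>) borel (\<lambda>\<omega>. \<Sum>i\<in>I - {j}. c i * Y i \<omega>)"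
    using I by (intro indep_vars_sum) auto
  moreover have "AE \<omega> in M. c j * Y j \<omega> \<noteq> x" for x
    using cont[OF j(1), of "x / c j"]
    by (rule AE_mp) (use j(2) in \<open>auto simp: field_simps\<close>)
  ultimately have "AE \<omega> in M. c j * Y j \<omega> + (\<Sum>i\<in>I - {j}. c i * Y i \<omega>) \<noteq> 0"
    by (rule indep_var_AE_add_neq_0)
  then show ?thesis using I j by (simp add: sum.remove)
qed

text \<open>A relation between the order statistics is, on each of the finitely many orderings of
  the sample, a relation between the sample variables themselves.\<close>

lemma (in prob_space) order_stat_AE_lincomb_neq_0:
  assumes indep: "indep_vars (\<lambda>_. borel) Y {1..n}"
    and cont: "\<And>i x. i \<in> {1..n} \<Longrightarrow> AE \<omega> in M. Y i \<omega> \<noteq> x"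
    and j: "j \<in> {1..n}" "c j \<noteq> 0"
  shows "AE \<omega> in M. (\<Sum>i\<in>{1..n}. c i * order_stat n Y i \<omega>) \<noteq> 0"
proof -
  have "AE \<omega> in M. (\<Sum>i\<in>{1..n}. c i * Y (p i) \<omega>) \<noteq> 0" if p: "p permutes {1..n}" for p
  proof -
    \<comment> \<open>Reindexing moves the permutation from the variables to the coefficients; the
      nonzero coefficient then sits at index \<open>p j\<close>.\<close>
    have "(\<Sum>i\<in>{1..n}. c i * Y (p i) \<omega>) = (\<Sum>i\<in>{1..n}. c (inv_into UNIV p i) * Y i \<omega>)" for \<omega>
      using sum.permute[OF p, of "\<lambda>i. c (inv_into UNIV p i) * Y i \<omega>"]
      by (simp add: comp_def permutes_inverses[OF p])
    moreover have "AE \<omega> in M. (\<Sum>i\<in>{1..n}. c (inv_into UNIV p i) * Y i \<omega>) \<noteq> 0"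
    proof (rule indep_vars_AE_lincomb_neq_0)
      show "p j \<in> {1..n}" using permutes_in_image[OF p] j by blast
      show "c (inv_into UNIV p (p j)) \<noteq> 0" using j by (simp add: permutes_inverses[OF p])
    qed (use indep cont in auto)
    ultimately show ?thesis by simp
  qed
  then have "AE \<omega> in M. \<forall>p\<in>{p. p permutes {1..n}}. (\<Sum>i\<in>{1..n}. c i * Y (p i) \<omega>) \<noteq> 0"
    by (intro AE_finite_allI) (simp_all add: finite_permutations)
  then show ?thesis
  proof eventually_elim
    case (elim \<omega>)
    obtain p where "p permutes {1..n}" "\<And>i. i \<in> {1..n} \<Longrightarrow> order_stat n Y i \<omega> = Y (p i) \<omega>"
      by (rule order_stat_permutation[of n Y \<omega>]) blast
    with elim show ?case by simp
  qed
qed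

section \<open>Linear invariant prediction\<close>

lemma det_mat_2: "det (mat 2 2 f :: 'b::comm_ring_1 mat) = f (0, 0) * f (1, 1) - f (0, 1) * f (1, 0)"
proof -
  have "det (mat 2 2 f) = (\<Sum>j<2. mat 2 2 f $$ (0, j) * cofactor (mat 2 2 f) 0 j)"
    by (rule laplace_expansion_row) auto
  moreover have "{..<2} = {0, 1 :: nat}" by auto
  moreover have "cofactor (mat 2 2 f) 0 j = (-1) ^ j * mat_delete (mat 2 2 f) 0 j $$ (0, 0)" for j
    unfolding cofactor_def by (subst det_single) (simp_all add: mat_delete_def)
  ultimately show ?thesis
    by (simp add: mat_delete_def)
qed

lemma det_mspe_mat:
  "det (mspe_mat M r X s t a b) =
    (\<integral>\<omega>. (a \<bullet> rv_vec r X \<omega> - X s \<omega>)\<^sup>2 \<partial>M) * (\<integral>\<omega>. (b \<bullet> rv_vec r X \<omega> - X t \<omega>)\<^sup>2 \<partial>M)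
    - (\<integral>\<omega>. (a \<bullet> rv_vec r X \<omega> - X s \<omega>) * (b \<bullet> rv_vec r X \<omega> - X t \<omega>) \<partial>M)\<^sup>2"
  by (simp add: mspe_mat_def det_mat_2 outer_prod_def pred_error_def power2_eq_square mult.commute)

lemma scalar_prod_rv_vec:
  "v \<in> carrier_vec r \<Longrightarrow> v \<bullet> rv_vec r X \<omega> = (\<Sum>i<r. v $ i * X (i + 1) \<omega>)"
  by (simp add: scalar_prod_def rv_vec_def lessThan_atLeast0)

lemma square_integrable_scalar_prod_rv_vec:
  assumes "\<And>i. i \<in> {1..r} \<Longrightarrow> square_integrable M (X i)" "v \<in> carrier_vec r"
  shows "square_integrable M (\<lambda>\<omega>. v \<bullet> rv_vec r X \<omega>)"
  unfolding scalar_prod_rv_vec[OF assms(2)]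
  by (intro square_integrable_sum square_integrable_cmult assms(1)) auto

lemma integral_scalar_prod_rv_vec_mult:
  assumes "\<And>i. i \<in> {1..r} \<Longrightarrow> square_integrable M (X i)" "square_integrable M U" "v \<in> carrier_vec r"
  shows "(\<integral>\<omega>. (v \<bullet> rv_vec r X \<omega>) * U \<omega> \<partial>M) = (\<Sum>i<r. v $ i * (\<integral>\<omega>. X (i + 1) \<omega> * U \<omega> \<partial>M))"
proof -
  have int: "integrable M (\<lambda>\<omega>. X (i + 1) \<omega> * U \<omega>)" if "i < r" for i
    using that by (intro square_integrable_mult assms) auto
  have "(\<integral>\<omega>. (v \<bullet> rv_vec r X \<omega>) * U \<omega> \<partial>M) = (\<integral>\<omega>. (\<Sum>i<r. v $ i * (X (i + 1) \<omega> * U \<omega>)) \<partial>M)"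
    unfolding scalar_prod_rv_vec[OF assms(3)] by (simp add: sum_distrib_right mult.assoc)
  also have "\<dots> = (\<Sum>i<r. \<integral>\<omega>. v $ i * (X (i + 1) \<omega> * U \<omega>) \<partial>M)"
    using int by (intro Bochner_Integration.integral_sum) auto
  also have "\<dots> = (\<Sum>i<r. v $ i * (\<integral>\<omega>. X (i + 1) \<omega> * U \<omega> \<partial>M))"
    by simp
  finally show ?thesis .
qed

text \<open>The deviation from the candidate pair is linear in the observations, hence orthogonal to
  the residuals \<open>U\<close> and \<open>V\<close>. The assumption \<open>indep\<close> makes the
  Gram matrix of these residuals positive definite and lets a deviation with zero second moment have
  only zero coefficients.\<close>

lemma (in prob_space) joint_BLIP_iff_normal_equations:
  assumes sq: "\<And>i. i \<in> {1..r} \<Longrightarrow> square_integrable M (X i)"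
      "square_integrable M (X s)" "square_integrable M (X t)"
    and indep: "\<And>v p q. v \<in> carrier_vec r \<Longrightarrow> v \<noteq> 0\<^sub>v r \<or> p \<noteq> 0 \<or> q \<noteq> 0 \<Longrightarrow>
      AE \<omega> in M. v \<bullet> rv_vec r X \<omega> + p * X s \<omega> + q * X t \<omega> \<noteq> 0"
    and carrier: "a0 \<in> carrier_vec r" "b0 \<in> carrier_vec r"
    and normal_a: "\<And>k. k \<in> {1..r} \<Longrightarrow> (\<integral>\<omega>. (a0 \<bullet> rv_vec r X \<omega>) * X k \<omega> \<partial>M) = (\<integral>\<omega>. X s \<omega> * X k \<omega> \<partial>M)"
    and normal_b: "\<And>k. k \<in> {1..r} \<Longrightarrow> (\<integral>\<omega>. (b0 \<bullet> rv_vec r X \<omega>) * X k \<omega> \<partial>M) = (\<integral>\<omega>. X t \<omega> * X k \<omega> \<partial>M)"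
  shows "joint_BLIP M r X s t a b \<longleftrightarrow> a = a0 \<and> b = b0"
proof -
  define R where "R = rv_vec r X"
  have R: "R \<omega> \<in> carrier_vec r" for \<omega>
    by (simp add: R_def rv_vec_def)
  define U where "U = (\<lambda>\<omega>. a0 \<bullet> R \<omega> - X s \<omega>)"
  define V where "V = (\<lambda>\<omega>. b0 \<bullet> R \<omega> - X t \<omega>)"
  have sqR: "square_integrable M (\<lambda>\<omega>. v \<bullet> R \<omega>)" if "v \<in> carrier_vec r" for v
    unfolding R_def using sq(1) that by (rule square_integrable_scalar_prod_rv_vec)
  have sqU: "square_integrable M U" and sqV: "square_integrable M V"
    unfolding U_def V_def using sq carrier by (auto intro!: square_integrable_diff sqR)
  have orth_gen: "(\<integral>\<omega>. (c \<bullet> R \<omega> - X q \<omega>) * (v \<bullet> R \<omega>) \<partial>M) = 0"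
    if c: "c \<in> carrier_vec r" and v: "v \<in> carrier_vec r" and q: "square_integrable M (X q)"
      and n: "\<And>k. k \<in> {1..r} \<Longrightarrow> (\<integral>\<omega>. (c \<bullet> R \<omega>) * X k \<omega> \<partial>M) = (\<integral>\<omega>. X q \<omega> * X k \<omega> \<partial>M)"
    for c v q
  proof -
    let ?W = "\<lambda>\<omega>. c \<bullet> R \<omega> - X q \<omega>"
    have W: "square_integrable M ?W"
      by (intro square_integrable_diff sqR c q)
    have "(\<integral>\<omega>. ?W \<omega> * (v \<bullet> R \<omega>) \<partial>M) = (\<integral>\<omega>. (v \<bullet> R \<omega>) * ?W \<omega> \<partial>M)"
      by (simp add: mult.commute)
    also have "\<dots> = (\<Sum>i<r. v $ i * (\<integral>\<omega>. X (i + 1) \<omega> * ?W \<omega> \<partial>M))"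
      using integral_scalar_prod_rv_vec_mult[OF sq(1) W v] by (simp add: R_def)
    also have "\<dots> = 0"
    proof (rule sum.neutral, rule ballI)
      fix i assume "i \<in> {..<r}"
      then have i: "i + 1 \<in> {1..r}" by auto
      have "(\<integral>\<omega>. X (i + 1) \<omega> * ?W \<omega> \<partial>M) =
          (\<integral>\<omega>. (c \<bullet> R \<omega>) * X (i + 1) \<omega> - X q \<omega> * X (i + 1) \<omega> \<partial>M)"
        by (simp add: algebra_simps)
      also have "\<dots> = 0"
        using n[OF i] square_integrable_mult[OF sqR[OF c] sq(1)[OF i]]
          square_integrable_mult[OF q sq(1)[OF i]] by simp
      finally show "v $ i * (\<integral>\<omega>. X (i + 1) \<omega> * ?W \<omega> \<partial>M) = 0" by simp
    qed
    finally show ?thesis .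
  qed
  have orth: "(\<integral>\<omega>. U \<omega> * (v \<bullet> R \<omega>) \<partial>M) = 0" "(\<integral>\<omega>. V \<omega> * (v \<bullet> R \<omega>) \<partial>M) = 0"
    if "v \<in> carrier_vec r" for v
    unfolding U_def V_def
    by (rule orth_gen[OF carrier(1) that sq(2) normal_a[folded R_def]]
        orth_gen[OF carrier(2) that sq(3) normal_b[folded R_def]]; assumption)+
  have pd: "0 < (\<integral>\<omega>. (x * U \<omega> + y * V \<omega>)\<^sup>2 \<partial>M)" if "x \<noteq> 0 \<or> y \<noteq> 0" for x y
  proof (rule integral_square_pos)
    show "square_integrable M (\<lambda>\<omega>. x * U \<omega> + y * V \<omega>)"
      by (intro square_integrable_add square_integrable_cmult sqU sqV)
    \<comment> \<open>The coefficients \<open>-x\<close> and \<open>-y\<close> at \<open>X s\<close>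
      and \<open>X t\<close> are not both zero, so this combination is nontrivial whatever
      \<open>a0\<close> and \<open>b0\<close> are.\<close>
    have "x * U \<omega> + y * V \<omega> = (x \<cdot>\<^sub>v a0 + y \<cdot>\<^sub>v b0) \<bullet> R \<omega> + (- x) * X s \<omega> + (- y) * X t \<omega>" for \<omega>
      using carrier R[of \<omega>]
      by (simp add: U_def V_def add_scalar_prod_distrib[of _ r] algebra_simps)
    then show "AE \<omega> in M. x * U \<omega> + y * V \<omega> \<noteq> 0"
      using indep[of "x \<cdot>\<^sub>v a0 + y \<cdot>\<^sub>v b0" "- x" "- y"] that carrier by (simp add: R_def)
  qed
  have null: "v = 0\<^sub>v r" if v: "v \<in> carrier_vec r" and "(\<integral>\<omega>. (v \<bullet> R \<omega>)\<^sup>2 \<partial>M) = 0" for v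
  proof (rule ccontr)
    assume "v \<noteq> 0\<^sub>v r"
    then have "AE \<omega> in M. v \<bullet> R \<omega> \<noteq> 0"
      using indep[OF v, of 0 0] by (simp add: R_def)
    with integral_square_pos[OF sqR[OF v]] that(2) show False by simp
  qed
  let ?D = "\<lambda>a b. det (mspe_mat M r X s t a b)"
  have shift: "c \<bullet> R \<omega> - X q \<omega> = (c0 \<bullet> R \<omega> - X q \<omega>) + (c - c0) \<bullet> R \<omega>"
    if "c \<in> carrier_vec r" "c0 \<in> carrier_vec r" for c c0 q \<omega>
    using that R[of \<omega>] by (simp add: minus_scalar_prod_distrib[of _ r])
  have D: "?D a b =
      (\<integral>\<omega>. (U \<omega> + (a - a0) \<bullet> R \<omega>)\<^sup>2 \<partial>M) * (\<integral>\<omega>. (V \<omega> + (b - b0) \<bullet> R \<omega>)\<^sup>2 \<partial>M)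
      - (\<integral>\<omega>. (U \<omega> + (a - a0) \<bullet> R \<omega>) * (V \<omega> + (b - b0) \<bullet> R \<omega>) \<partial>M)\<^sup>2"
    if "a \<in> carrier_vec r" "b \<in> carrier_vec r" for a b
    unfolding det_mspe_mat U_def V_def R_def[symmetric]
      shift[OF that(1) carrier(1)] shift[OF that(2) carrier(2)] ..
  have D0: "?D a0 b0 = (\<integral>\<omega>. (U \<omega>)\<^sup>2 \<partial>M) * (\<integral>\<omega>. (V \<omega>)\<^sup>2 \<partial>M) - (\<integral>\<omega>. U \<omega> * V \<omega> \<partial>M)\<^sup>2"
    by (simp add: det_mspe_mat U_def V_def R_def)
  have min: "?D a0 b0 \<le> ?D a b"
    and uniq: "?D a b \<le> ?D a0 b0 \<Longrightarrow> a = a0 \<and> b = b0"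
    if ab: "a \<in> carrier_vec r" "b \<in> carrier_vec r" for a b
  proof -
    have ca: "a - a0 \<in> carrier_vec r" and cb: "b - b0 \<in> carrier_vec r"
      using ab carrier by auto
    note perturb = gram_det_perturb[OF sqU sqV sqR[OF ca] sqR[OF cb]
        orth(1)[OF ca] orth(1)[OF cb] orth(2)[OF ca] orth(2)[OF cb] pd]
    show "?D a0 b0 \<le> ?D a b"
      unfolding D[OF ab] D0 using perturb(1) by simp
    assume "?D a b \<le> ?D a0 b0"
    then have "a - a0 = 0\<^sub>v r \<and> b - b0 = 0\<^sub>v r"
      unfolding D[OF ab] D0 using perturb(2) null[OF ca] null[OF cb] by simp
    then show "a = a0 \<and> b = b0"
      using ab carrier by (auto simp: vec_eq_iff)
  qed
  show ?thesis
  proof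
    assume "joint_BLIP M r X s t a b"
    \<comment> \<open>A minimizer admits no strictly better competitor; tested against
      \<open>(a0, b0)\<close>, this is the inequality that \<open>uniq\<close> expects.\<close>
    then have "a \<in> carrier_vec r" "b \<in> carrier_vec r" "\<not> ?D a0 b0 < ?D a b"
      using carrier by (auto simp: joint_BLIP_def is_arg_min_def)
    then show "a = a0 \<and> b = b0" by (intro uniq) auto
  next
    assume "a = a0 \<and> b = b0"
    then show "joint_BLIP M r X s t a b"
      using carrier min by (auto simp: joint_BLIP_def is_arg_min_def not_less)
  qed
qed

section \<open>Matrix inversion and second moments in location-scale form\<close>

text \<open>A trivial kernel gives a nonzero determinant, so \<open>mat_inverse\<close> does not
  return \<open>None\<close> and \<open>inv_mat\<close> is a genuine inverse.\<close>

lemma inv_mat_inverts: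
  assumes A: "A \<in> carrier_mat n n" and ker: "\<And>v. v \<in> carrier_vec n \<Longrightarrow> A *\<^sub>v v = 0\<^sub>v n \<Longrightarrow> v = 0\<^sub>v n"
  shows "invertible_mat A" "inv_mat A \<in> carrier_mat n n" "A * inv_mat A = 1\<^sub>m n"
proof -
  have "det A \<noteq> 0" using det_0_iff_vec_prod_zero[OF A] ker by blast
  then have "A \<in> Units (ring_mat TYPE(real) n ())" by (rule det_non_zero_imp_unit[OF A])
  then obtain B where B: "mat_inverse A = Some B"
    using mat_inverse(1)[OF A, where b = "()"] by (cases "mat_inverse A") auto
  note inv = mat_inverse(2)[OF A B]
  then show "inv_mat A \<in> carrier_mat n n" "A * inv_mat A = 1\<^sub>m n"
    by (simp_all add: inv_mat_def B)
  have "square_mat A \<and> inverts_mat A B \<and> inverts_mat B A"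
    using A inv by (auto simp: inverts_mat_def)
  then show "invertible_mat A" unfolding invertible_mat_def by blast
qed

text \<open>Splitting the product moment into covariance and product of means and factoring out
  \<open>\<sigma>\<^sup>2\<close> produces the shift \<open>\<mu> / \<sigma>\<close>. This is the
  origin of the entries of \<open>\<Gamma>\<close> and \<open>\<Delta>\<close>.\<close>

lemma (in prob_space) integral_mult_location_scale:
  assumes U: "square_integrable M U" and V: "square_integrable M V" and "\<sigma> \<noteq> 0"
  shows "(\<integral>\<omega>. (\<mu> + \<sigma> * U \<omega>) * (\<mu> + \<sigma> * V \<omega>) \<partial>M) =
    \<sigma>\<^sup>2 * (covariance M U V + ((\<integral>\<omega>. U \<omega> \<partial>M) + \<mu> / \<sigma>) * ((\<integral>\<omega>. V \<omega> \<partial>M) + \<mu> / \<sigma>))"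
proof -
  note int = square_integrable_mult[OF U V] square_integrable_imp_integrable'[OF U]
    square_integrable_imp_integrable'[OF V]
  define u v where "u = (\<integral>\<omega>. U \<omega> \<partial>M)" and "v = (\<integral>\<omega>. V \<omega> \<partial>M)"
  have "covariance M U V = (\<integral>\<omega>. U \<omega> * V \<omega> - v * U \<omega> - u * V \<omega> + u * v \<partial>M)"
    by (simp add: covariance_def u_def v_def algebra_simps)
  also have "\<dots> = (\<integral>\<omega>. U \<omega> * V \<omega> \<partial>M) - u * v"
    using int by (simp add: u_def v_def prob_space)
  finally have cov: "covariance M U V = (\<integral>\<omega>. U \<omega> * V \<omega> \<partial>M) - u * v" .
  have "(\<integral>\<omega>. (\<mu> + \<sigma> * U \<omega>) * (\<mu> + \<sigma> * V \<omega>) \<partial>M) =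
      (\<integral>\<omega>. \<sigma>\<^sup>2 * (U \<omega> * V \<omega>) + \<mu> * \<sigma> * U \<omega> + \<mu> * \<sigma> * V \<omega> + \<mu>\<^sup>2 \<partial>M)"
    by (simp add: power2_eq_square algebra_simps)
  also have "\<dots> = \<sigma>\<^sup>2 * (\<integral>\<omega>. U \<omega> * V \<omega> \<partial>M) + \<mu> * \<sigma> * u + \<mu> * \<sigma> * v + \<mu>\<^sup>2"
    using int by (simp add: u_def v_def prob_space)
  finally show ?thesis
    using \<open>\<sigma> \<noteq> 0\<close> by (simp add: cov u_def[symmetric] v_def[symmetric] power2_eq_square field_simps)
qed

text \<open>The equivalence expresses existence and uniqueness of the minimizer together.
  Invertibility of \<open>\<Gamma>\<close> is part of the conclusion because \<open>inv_mat\<close>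
  is unspecified on singular matrices.\<close>

theorem theorem2:
  fixes M :: "'a measure"
    and f :: "real \<Rightarrow> real"
    and \<mu> \<sigma> \<delta> :: real
    and r s t n :: nat
    and Y X Z :: "nat \<Rightarrow> 'a \<Rightarrow> real"
    and \<alpha> :: "nat \<Rightarrow> real"
    and \<alpha>v one :: "real vec"
    and \<Sigma> \<Gamma> :: "real mat"
    and \<omega>v \<Delta> :: "nat \<Rightarrow> real vec"
  assumes prob: "prob_space M"
    and f: "probability_density f"
    and \<sigma>_pos: "\<sigma> > 0"
    and \<delta>: "\<delta> = \<mu> / \<sigma>"
    and indices: "1 \<le> r" "r < s" "s < t" "t \<le> n"
    and indep: "prob_space.indep_vars M (\<lambda>_. borel) Y {1..n}"
    and density: "\<And>i. i \<in> {1..n} \<Longrightarrow>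
          distributed M lborel (Y i) (\<lambda>x. ennreal (1 / \<sigma> * f ((x - \<mu>) / \<sigma>)))"
    and X: "\<And>i \<omega>. X i \<omega> = order_stat n Y i \<omega>"
    and Z: "\<And>i \<omega>. Z i \<omega> = (X i \<omega> - \<mu>) / \<sigma>"
    and second_moments: "\<And>i. i \<in> {1..n} \<Longrightarrow> integrable M (\<lambda>\<omega>. (Z i \<omega>)\<^sup>2)"
    and \<alpha>: "\<And>i. \<alpha> i = (\<integral>\<omega>. Z i \<omega> \<partial>M)"
    and \<alpha>v: "\<alpha>v = vec r (\<lambda>i. \<alpha> (i + 1))"
    and one: "one = vec r (\<lambda>_. 1)"
    and \<Sigma>: "\<Sigma> = cov_mat M r Z"
    and \<Sigma>_pd: "positive_definite \<Sigma>"
    and \<omega>v: "\<And>q. \<omega>v q = cov_vec M r Z q"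
    and \<Gamma>: "\<Gamma> = \<Sigma> + outer_prod (\<alpha>v + \<delta> \<cdot>\<^sub>v one) (\<alpha>v + \<delta> \<cdot>\<^sub>v one)"
    and \<Delta>: "\<And>q. \<Delta> q = \<omega>v q + (\<alpha> q + \<delta>) \<cdot>\<^sub>v (\<alpha>v + \<delta> \<cdot>\<^sub>v one)"
  shows "invertible_mat \<Gamma> \<and>
    (\<forall>a b. joint_BLIP M r X s t a b \<longleftrightarrow>
       a = inv_mat \<Gamma> *\<^sub>v \<Delta> s \<and> b = inv_mat \<Gamma> *\<^sub>v \<Delta> t)"
proof -
  interpret prob_space M by (rule prob)
  have Y_meas: "Y i \<in> borel_measurable M" if "i \<in> {1..n}" for i
    using distributed_measurable[OF density[OF that]] by simp
  have X_eq: "X i = order_stat n Y i" for i using X by (simp add: fun_eq_iff)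
  have XZ: "X i \<omega> = \<mu> + \<sigma> * Z i \<omega>" for i \<omega> using Z \<sigma>_pos by simp
  have sqZ: "square_integrable M (Z i)" if i: "i \<in> {1..n}" for i
  proof -
    have [measurable]: "X i \<in> borel_measurable M"
      unfolding X_eq using Y_meas i by (rule borel_measurable_order_stat)
    have "Z i \<in> borel_measurable M"
      unfolding Z[abs_def] by measurable
    then show ?thesis using second_moments[OF i] by (simp add: square_integrable_def)
  qed
  have sqX: "square_integrable M (X i)" if i: "i \<in> {1..n}" for i
    unfolding XZ[abs_def]
    by (intro square_integrable_add square_integrable_const square_integrable_cmult sqZ i)
  have st: "s \<in> {1..n}" "t \<in> {1..n}" using indices by auto
  have rn: "i \<in> {1..n}" if "i \<in> {1..r}" for i using that indices by auto
  have moment: "(\<integral>\<omega>. X i \<omega> * X j \<omega> \<partial>M) =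
      \<sigma>\<^sup>2 * (covariance M (Z i) (Z j) + (\<alpha> i + \<delta>) * (\<alpha> j + \<delta>))"
    if "i \<in> {1..n}" "j \<in> {1..n}" for i j
    unfolding XZ \<alpha> \<delta> using sqZ that \<sigma>_pos by (intro integral_mult_location_scale) auto
  have indep_X: "AE \<omega> in M. v \<bullet> rv_vec r X \<omega> + p * X s \<omega> + q * X t \<omega> \<noteq> 0"
    if v: "v \<in> carrier_vec r" and nz: "v \<noteq> 0\<^sub>v r \<or> p \<noteq> 0 \<or> q \<noteq> 0" for v p q
  proof -
    \<comment> \<open>Extends the coefficients by zeros to all order statistics. The cases do not
      clash since r < s < t, and \<open>i - 1\<close> converts to vector positions counted from
      0.\<close>
    define c where "c i = (if i \<in> {1..r} then v $ (i - 1) else if i = s then p else if i = t then q else 0)" for i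
    have "\<exists>j\<in>{1..n}. c j \<noteq> 0"
      using nz
    proof (elim disjE)
      assume "v \<noteq> 0\<^sub>v r"
      then obtain i where "i < r" "v $ i \<noteq> 0" using v by (auto simp: vec_eq_iff)
      then show ?thesis using rn[of "i + 1"] by (intro bexI[of _ "i + 1"]) (auto simp: c_def)
    qed (use st indices in \<open>auto simp: c_def intro: bexI[of _ s] bexI[of _ t]\<close>)
    then obtain j where j: "j \<in> {1..n}" "c j \<noteq> 0" by blast
    have "(\<Sum>i\<in>{1..n}. c i * X i \<omega>) = v \<bullet> rv_vec r X \<omega> + p * X s \<omega> + q * X t \<omega>" for \<omega>
    proof -
      have "(\<Sum>i\<in>{1..n}. c i * X i \<omega>) = (\<Sum>i\<in>{1..r} \<union> {s, t}. c i * X i \<omega>)"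
        using st rn by (intro sum.mono_neutral_right) (auto simp: c_def)
      also have "\<dots> = (\<Sum>i\<in>{1..r}. c i * X i \<omega>) + (\<Sum>i\<in>{s, t}. c i * X i \<omega>)"
        using indices by (intro sum.union_disjoint) auto
      also have "(\<Sum>i\<in>{s, t}. c i * X i \<omega>) = p * X s \<omega> + q * X t \<omega>"
        using indices by (simp add: c_def)
      also have "(\<Sum>i\<in>{1..r}. c i * X i \<omega>) = (\<Sum>i<r. c (i + 1) * X (i + 1) \<omega>)"
        by (rule sum.reindex_bij_witness[of _ "\<lambda>i. i + 1" "\<lambda>i. i - 1"]) auto
      also have "\<dots> = v \<bullet> rv_vec r X \<omega>"
        unfolding scalar_prod_rv_vec[OF v] by (simp add: c_def)
      finally show ?thesis by simp
    qed
    moreover have "AE \<omega> in M. (\<Sum>i\<in>{1..n}. c i * X i \<omega>) \<noteq> 0"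
      unfolding X
      by (rule order_stat_AE_lincomb_neq_0[where j = j])
        (use indep j in \<open>auto intro: distributed_lborel_AE_neq[OF density]\<close>)
    ultimately show ?thesis by simp
  qed
  have \<Gamma>_carrier: "\<Gamma> \<in> carrier_mat r r"
    by (simp add: \<Gamma> \<Sigma> cov_mat_def outer_prod_def \<alpha>v one)
  \<comment> \<open>The entry is taken at \<open>(k, i)\<close>, by symmetry of the covariance, so
    that summing over \<open>i\<close> yields row \<open>k\<close> of a matrix-vector
    product.\<close>
  have \<Gamma>_moment: "(\<integral>\<omega>. X (i + 1) \<omega> * X (k + 1) \<omega> \<partial>M) = \<sigma>\<^sup>2 * \<Gamma> $$ (k, i)"
    if "i < r" "k < r" for i k
  proof -
    have "covariance M (Z (i + 1)) (Z (k + 1)) = covariance M (Z (k + 1)) (Z (i + 1))"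
      by (simp add: covariance_def mult.commute)
    then show ?thesis
      using that rn[of "i + 1"] rn[of "k + 1"]
      by (simp add: moment \<Gamma> \<Sigma> cov_mat_def outer_prod_def \<alpha>v one)
  qed
  have \<Gamma>_mult: "(\<integral>\<omega>. (v \<bullet> rv_vec r X \<omega>) * X (k + 1) \<omega> \<partial>M) = \<sigma>\<^sup>2 * (\<Gamma> *\<^sub>v v) $ k"
    if v: "v \<in> carrier_vec r" and k: "k < r" for v k
  proof -
    have "(\<integral>\<omega>. (v \<bullet> rv_vec r X \<omega>) * X (k + 1) \<omega> \<partial>M) =
        (\<Sum>i<r. v $ i * (\<integral>\<omega>. X (i + 1) \<omega> * X (k + 1) \<omega> \<partial>M))"
      using k v by (intro integral_scalar_prod_rv_vec_mult sqX rn) auto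
    also have "\<dots> = (\<Sum>i<r. \<sigma>\<^sup>2 * (\<Gamma> $$ (k, i) * v $ i))"
      using k by (intro sum.cong) (simp_all add: \<Gamma>_moment[simplified])
    also have "\<dots> = \<sigma>\<^sup>2 * (\<Gamma> *\<^sub>v v) $ k"
      using \<Gamma>_carrier v k by (simp add: scalar_prod_def lessThan_atLeast0 sum_distrib_left)
    finally show ?thesis .
  qed
  \<comment> \<open>By \<open>\<Gamma>_mult\<close>, a kernel vector makes
    \<open>v \<bullet> rv_vec r X\<close> orthogonal to every observation, hence to itself, although
    its second moment is positive unless \<open>v\<close> is zero.\<close>
  have ker: "v = 0\<^sub>v r" if v: "v \<in> carrier_vec r" and z: "\<Gamma> *\<^sub>v v = 0\<^sub>v r" for v
  proof (rule ccontr)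
    assume "v \<noteq> 0\<^sub>v r"
    then have "AE \<omega> in M. v \<bullet> rv_vec r X \<omega> \<noteq> 0"
      using indep_X[OF v, of 0 0] by simp
    moreover have sqv: "square_integrable M (\<lambda>\<omega>. v \<bullet> rv_vec r X \<omega>)"
      using v by (intro square_integrable_scalar_prod_rv_vec sqX rn)
    ultimately have "0 < (\<integral>\<omega>. (v \<bullet> rv_vec r X \<omega>) * (v \<bullet> rv_vec r X \<omega>) \<partial>M)"
      using integral_square_pos by (simp add: power2_eq_square)
    also have "\<dots> = (\<Sum>i<r. v $ i * (\<integral>\<omega>. X (i + 1) \<omega> * (v \<bullet> rv_vec r X \<omega>) \<partial>M))"
      using v sqv by (intro integral_scalar_prod_rv_vec_mult sqX rn)
    also have "\<dots> = 0"
      using \<Gamma>_mult[OF v] z by (intro sum.neutral) (simp add: mult.commute)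
    finally show False by simp
  qed
  note inv = inv_mat_inverts[OF \<Gamma>_carrier ker]
  have \<Delta>_carrier: "\<Delta> q \<in> carrier_vec r" for q
    by (simp add: \<Delta> \<omega>v cov_vec_def \<alpha>v one)
  have sol_carrier: "inv_mat \<Gamma> *\<^sub>v \<Delta> q \<in> carrier_vec r" for q
    using inv(2) \<Delta>_carrier by (rule mult_mat_vec_carrier)
  \<comment> \<open>Both sides equal \<open>\<sigma>\<^sup>2\<close> times entry
    \<open>k - 1\<close> of \<open>\<Delta> q\<close>: the left one because \<open>\<Gamma>\<close>
    cancels its inverse, the right one by \<open>moment\<close>.\<close>
  have normal: "(\<integral>\<omega>. ((inv_mat \<Gamma> *\<^sub>v \<Delta> q) \<bullet> rv_vec r X \<omega>) * X k \<omega> \<partial>M) = (\<integral>\<omega>. X q \<omega> * X k \<omega> \<partial>M)"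
    if k: "k \<in> {1..r}" and q: "q \<in> {1..n}" for k q
  proof -
    have k': "k - 1 < r" "k - 1 + 1 = k" using k by auto
    have "\<Gamma> *\<^sub>v (inv_mat \<Gamma> *\<^sub>v \<Delta> q) = (\<Gamma> * inv_mat \<Gamma>) *\<^sub>v \<Delta> q"
      by (rule assoc_mult_mat_vec[symmetric, OF \<Gamma>_carrier inv(2) \<Delta>_carrier])
    also have "\<dots> = \<Delta> q"
      using inv(3) \<Delta>_carrier by simp
    finally have "(\<integral>\<omega>. ((inv_mat \<Gamma> *\<^sub>v \<Delta> q) \<bullet> rv_vec r X \<omega>) * X k \<omega> \<partial>M) = \<sigma>\<^sup>2 * \<Delta> q $ (k - 1)"
      using \<Gamma>_mult[OF sol_carrier k'(1)] unfolding k'(2) by simp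
    also have "\<dots> = (\<integral>\<omega>. X k \<omega> * X q \<omega> \<partial>M)"
      using k' k by (simp add: moment[OF rn[OF k] q] \<Delta> \<omega>v cov_vec_def \<alpha>v one algebra_simps)
    finally show ?thesis by (simp add: mult.commute)
  qed
  have "joint_BLIP M r X s t a b \<longleftrightarrow> a = inv_mat \<Gamma> *\<^sub>v \<Delta> s \<and> b = inv_mat \<Gamma> *\<^sub>v \<Delta> t" for a b
    using sqX rn st indep_X sol_carrier normal
    by (intro joint_BLIP_iff_normal_equations) auto
  with inv(1) show ?thesis by blast
qed

end
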